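(* Let $R$ be a weakly $\sigma$-distributive Dedekind complete algebra, $(T,d)$ a compact metric space with Borel $\sigma$-algebra $\Sigma$, $\mu:\Sigma\to R$ a positive additive regular mapping, $F:T\to 2^R$ a multifunction and $E\in\Sigma$. If $F$ is bounded and $R$ is moreover super Dedekind complete, then the $( * )$-integral $\Phi(F,E)$ is closed, i.e. $\Phi(F,E)=\mathrm{cl}(\Phi(F,E))$.
   Context: A Riesz space $R$ is Dedekind complete if every nonempty subset bounded from above (below) has a supremum $\bigvee$ (infimum $\bigwedge$) in $R$; it is super Dedekind complete if moreover every nonempty subset bounded from above contains a countable subset having the same supremum. A $(D)$-sequence, or regulator, in $R$ is a bounded double sequence $(a_{i,j})_{i,j}$ with $a_{i,j}\ge a_{i,j+1}$ for all $i,j\in\mathbb{N}$ and $\bigwedge_j a_{i,j}=0$ for all $i$. A Dedekind complete $R$ is weakly $\sigma$-distributive if $\bigwedge_{\varphi\in\mathbb{N}^{\mathbb{N}}}\left(\bigvee_{i=1}^{\infty}a_{i,\varphi(i)}\right)=0$ for every $(D)$-sequence. A Dedekind complete Riesz space $R$ is an algebra if it carries a map $\cdot:R\times R\to R$ compatible with sums, order, suprema and infima: it is additive in each variable; if $r\ge s$ and $t\ge0$ then $r\cdot t\ge s\cdot t$ and $t\cdot r\ge t\cdot s$; and if a net $(a_\lambda)$ decreases to $0$ and $b\ge0$ then $b\cdot a_\lambda$ and $a_\lambda\cdot b$ decrease to $0$. $\mu$ is regular if for every $E\in\Sigma$ there is a $(D)$-sequence $(a^E_{i,j})_{i,j}$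 such that for every $\varphi:\mathbb{N}\to\mathbb{N}$ there are a compact $K$ and an open $U$ with $K\subset E\subset U$ and $\mu(U\setminus K)\le\bigvee_i a^E_{i,\varphi(i)}$. A multifunction $F$ is bounded if there is a positive element $L\in R$ with $F(t)\subset[-L,L]$ for all $t\in T$. A gage on $T$ is a map $\gamma:T\to\mathbb{R}^+$ (strictly positive reals). A partition of $E\in\Sigma$ is a finite family $\{(E_i,t_i):i=1,\dots,k\}$ with $E_i\in\Sigma$, $t_i\in E_i$, $\mu(E_i\cap E_j)=0$ for $i\ne j$ and $\bigcup_i E_i=E$; it is $\gamma$-fine if $d(w,t_i)<\gamma(t_i)$ for all $i$ and all $w\in E_i$. For $C\subset R$ and $r\in R$, $r\ge 0$, put $\mathcal{U}(C,r)=\{z\in R:\exists x\in C,\ |x-z|\le r\}$, and $\mathrm{cl}(C)=\bigcup_{(a_{i,j})}\bigcap_{\varphi\in\mathbb{N}^{\mathbb{N}}}\mathcal{U}(C,\bigvee_i a_{i,\varphi(i)})$, the union being over all $(D)$-sequences; $C$ is closed if $C=\mathrm{cl}(C)$. For sets $A_1,\dots,A_n\subset R$, $\sum_{i=1}^nA_i:=\mathrm{cl}(A_1+\dots+A_n)$ (closure of the algebraic sum); for $C\subset R$ and $r\in R$, $C\,r=\{c\cdot r:c\in C\}$. The $( * )$-integral $\Phi(F,E)$ of $F:T\to2^R$ on $E\in\Sigma$ is the set of all $z\in R$ for which there is a $(D)$-sequence $(a_{i,j})_{i,j}$ such that for all $\varphi\in\mathbb{N}^{\mathbb{N}}$ there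 is a gage $\gamma$ such that for every $\gamma$-fine partition $\{(E_i,t_i):i=1,\dots,k\}$ of $E$ there is $c\in\sum_{i=1}^kF(t_i)\mu(E_i)$ with $|z-c|\le\bigvee_{i=1}^\infty a_{i,\varphi(i)}$. *)

theory Defs
  imports "HOL-Analysis.Analysis" "HOL-Library.Lattice_Algebras" "HOL-Library.Set_Algebras"
begin

section \<open>Dedekind complete Riesz spaces\<close>

class dedekind_complete_riesz =
  ordered_real_vector + lattice_ab_group_add_abs + conditionally_complete_lattice

instance real :: dedekind_complete_riesz ..

(* Sup {} is an unspecified element, hence the requirement that C be nonempty. *)
definition super_Dedekind_complete :: "'a::dedekind_complete_riesz itself \<Rightarrow> bool" where
  "super_Dedekind_complete _ \<longleftrightarrow>
     (\<forall>S :: 'a set. S \<noteq> {} \<and> bdd_above S \<longrightarrow>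
        (\<exists>C. C \<subseteq> S \<and> countable C \<and> C \<noteq> {} \<and> Sup C = Sup S))"

definition D_sequence :: "(nat \<Rightarrow> nat \<Rightarrow> 'a::dedekind_complete_riesz) \<Rightarrow> bool" where
  "D_sequence a \<longleftrightarrow>
     (\<exists>u. \<forall>i j. \<bar>a i j\<bar> \<le> u) \<and>
     (\<forall>i j. a i (Suc j) \<le> a i j) \<and>
     (\<forall>i. (INF j. a i j) = 0)"

definition weakly_sigma_distributive :: "'a::dedekind_complete_riesz itself \<Rightarrow> bool" where
  "weakly_sigma_distributive _ \<longleftrightarrow>
     (\<forall>a :: nat \<Rightarrow> nat \<Rightarrow> 'a. D_sequence a \<longrightarrow>
        (INF \<phi> :: nat \<Rightarrow> nat. SUP i. a i (\<phi> i)) = 0)"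

section \<open>Algebras\<close>

(* A net is a family a indexed by a nonempty set I that is directed by the preorder le.
   The explicit bound is needed because Inf of a set unbounded below is unspecified. *)
definition decreases_to_zero ::
    "'i set \<Rightarrow> ('i \<Rightarrow> 'i \<Rightarrow> bool) \<Rightarrow> ('i \<Rightarrow> 'a::dedekind_complete_riesz) \<Rightarrow> bool" where
  "decreases_to_zero I le a \<longleftrightarrow>
     I \<noteq> {} \<and> reflp_on I le \<and> transp_on I le \<and>
     (\<forall>i\<in>I. \<forall>j\<in>I. \<exists>k\<in>I. le i k \<and> le j k) \<and>
     (\<forall>i\<in>I. \<forall>j\<in>I. le i j \<longrightarrow> a j \<le> a i) \<and>
     bdd_below (a ` I) \<and> (INF i\<in>I. a i) = 0"

(* The last clause ranges over nets whose index set lies in 'a itself; by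
   Dedekind_complete_algebra_net below it then holds for nets over arbitrary index types. *)
definition Dedekind_complete_algebra ::
    "('a::dedekind_complete_riesz \<Rightarrow> 'a \<Rightarrow> 'a) \<Rightarrow> bool" where
  "Dedekind_complete_algebra mul \<longleftrightarrow>
     (\<forall>r s t. mul (r + s) t = mul r t + mul s t) \<and>
     (\<forall>r s t. mul r (s + t) = mul r s + mul r t) \<and>
     (\<forall>r s t. s \<le> r \<and> 0 \<le> t \<longrightarrow> mul s t \<le> mul r t \<and> mul t s \<le> mul t r) \<and>
     (\<forall>(I :: 'a set) le a b. decreases_to_zero I le a \<and> 0 \<le> b \<longrightarrow>
        decreases_to_zero I le (\<lambda>i. mul b (a i)) \<and>
        decreases_to_zero I le (\<lambda>i. mul (a i) b))"

lemma Dedekind_complete_algebra_net: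
  fixes a :: "'i \<Rightarrow> 'a::dedekind_complete_riesz"
  assumes alg: "Dedekind_complete_algebra mul"
    and net: "decreases_to_zero I le a" and b: "0 \<le> b"
  shows "decreases_to_zero I le (\<lambda>i. mul b (a i)) \<and> decreases_to_zero I le (\<lambda>i. mul (a i) b)"
proof -
  have dir: "\<exists>k\<in>I. a k \<le> a i \<and> a k \<le> a j" if "i \<in> I" "j \<in> I" for i j
    using net that unfolding decreases_to_zero_def by meson
  have "I \<noteq> {}" "bdd_below (a ` I)" "(INF i\<in>I. a i) = 0"
    using net by (simp_all add: decreases_to_zero_def)
  moreover have "reflp_on (a ` I) (\<lambda>x y. y \<le> x)" "transp_on (a ` I) (\<lambda>x y. y \<le> x)"
    by (auto intro: reflp_onI transp_onI order_trans)
  ultimately have "decreases_to_zero (a ` I) (\<lambda>x y. y \<le> x) (\<lambda>x. x)"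
    unfolding decreases_to_zero_def using dir by simp
  then have "decreases_to_zero (a ` I) (\<lambda>x y. y \<le> x) (\<lambda>x. mul b x) \<and>
      decreases_to_zero (a ` I) (\<lambda>x y. y \<le> x) (\<lambda>x. mul x b)"
    using alg b unfolding Dedekind_complete_algebra_def by blast
  then have inf:
    "bdd_below ((\<lambda>i. mul b (a i)) ` I)" "(INF i\<in>I. mul b (a i)) = 0"
    "bdd_below ((\<lambda>i. mul (a i) b) ` I)" "(INF i\<in>I. mul (a i) b) = 0"
    by (simp_all add: decreases_to_zero_def image_image)
  have mono: "mul b x \<le> mul b y \<and> mul x b \<le> mul y b" if "x \<le> y" for x y
    using alg b that unfolding Dedekind_complete_algebra_def by blast
  show ?thesis
    using net inf mono unfolding decreases_to_zero_def by meson
qed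

section \<open>Regular set functions on the Borel sets\<close>

definition regular_mapping ::
    "('b::metric_space set \<Rightarrow> 'a::dedekind_complete_riesz) \<Rightarrow> bool" where
  "regular_mapping \<mu> \<longleftrightarrow>
     (\<forall>E \<in> sets borel. \<exists>a. D_sequence a \<and>
        (\<forall>\<phi> :: nat \<Rightarrow> nat. \<exists>K U. compact K \<and> open U \<and> K \<subseteq> E \<and> E \<subseteq> U \<and>
           \<mu> (U - K) \<le> (SUP i. a i (\<phi> i))))"

section \<open>Closure and sums of sets\<close>

definition nbhd :: "'a::dedekind_complete_riesz set \<Rightarrow> 'a \<Rightarrow> 'a set" where
  "nbhd C r = {z. \<exists>x\<in>C. \<bar>x - z\<bar> \<le> r}"

definition D_closure :: "'a::dedekind_complete_riesz set \<Rightarrow> 'a set" where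
  "D_closure C = (\<Union>a \<in> Collect D_sequence. \<Inter>\<phi> :: nat \<Rightarrow> nat. nbhd C (SUP i. a i (\<phi> i)))"

definition D_closed :: "'a::dedekind_complete_riesz set \<Rightarrow> bool" where
  "D_closed C \<longleftrightarrow> C = D_closure C"

(* The inner sum is the elementwise sum of sets; the empty sum is {0}. *)
definition closed_sum :: "nat \<Rightarrow> (nat \<Rightarrow> 'a::dedekind_complete_riesz set) \<Rightarrow> 'a set" where
  "closed_sum k A = D_closure (\<Sum>i=1..k. A i)"

section \<open>The integral\<close>

definition bounded_multifunction :: "('b \<Rightarrow> 'a::dedekind_complete_riesz set) \<Rightarrow> bool" where
  "bounded_multifunction F \<longleftrightarrow> (\<exists>L. 0 \<le> L \<and> (\<forall>t. F t \<subseteq> {- L..L}))"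

definition gage :: "('b \<Rightarrow> real) \<Rightarrow> bool" where
  "gage \<gamma> \<longleftrightarrow> (\<forall>t. 0 < \<gamma> t)"

definition tagged_partition ::
    "('b::metric_space set \<Rightarrow> 'a::dedekind_complete_riesz) \<Rightarrow> 'b set \<Rightarrow>
     nat \<Rightarrow> (nat \<Rightarrow> 'b set) \<Rightarrow> (nat \<Rightarrow> 'b) \<Rightarrow> bool" where
  "tagged_partition \<mu> E k A t \<longleftrightarrow>
     (\<forall>i\<in>{1..k}. A i \<in> sets borel \<and> t i \<in> A i) \<and>
     (\<forall>i\<in>{1..k}. \<forall>j\<in>{1..k}. i \<noteq> j \<longrightarrow> \<mu> (A i \<inter> A j) = 0) \<and>
     (\<Union>i\<in>{1..k}. A i) = E"

definition gage_fine ::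
    "('b::metric_space \<Rightarrow> real) \<Rightarrow> nat \<Rightarrow> (nat \<Rightarrow> 'b set) \<Rightarrow> (nat \<Rightarrow> 'b) \<Rightarrow> bool" where
  "gage_fine \<gamma> k A t \<longleftrightarrow> (\<forall>i\<in>{1..k}. \<forall>w\<in>A i. dist w (t i) < \<gamma> (t i))"

definition star_integral ::
    "('a::dedekind_complete_riesz \<Rightarrow> 'a \<Rightarrow> 'a) \<Rightarrow> ('b::metric_space set \<Rightarrow> 'a) \<Rightarrow>
     ('b \<Rightarrow> 'a set) \<Rightarrow> 'b set \<Rightarrow> 'a set" where
  "star_integral mul \<mu> F E =
     {z. \<exists>a. D_sequence a \<and>
        (\<forall>\<phi> :: nat \<Rightarrow> nat. \<exists>\<gamma>. gage \<gamma> \<and>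
           (\<forall>k A t. tagged_partition \<mu> E k A t \<and> gage_fine \<gamma> k A t \<longrightarrow>
              (\<exists>c \<in> closed_sum k (\<lambda>i. (\<lambda>x. mul x (\<mu> (A i))) ` F (t i)).
                 \<bar>z - c\<bar> \<le> (SUP i. a i (\<phi> i)))))}"

end

theory Submission
  imports Defs
begin

text \<open>
  Let \<open>z\<close> lie in the closure of \<open>\<Phi> = star_integral mul \<mu> F E\<close>, witnessed by a regulator \<open>a\<close>. Points of
  \<open>\<Phi>\<close> approximate \<open>z\<close>, but there is one of them for every \<open>\<phi>\<close>, each with a regulator of its own, and
  uncountably many regulators cannot be merged into one. Super Dedekind completeness removes this
  obstacle: under weak \<open>\<sigma>\<close>-distributivity, each regulator may be replaced by a single sequence
  \<open>SUP i. a i (\<psi> n i)\<close> decreasing to \<open>0\<close> (\<open>D_sequence_null_sequence\<close>). So there are \<open>z\<^sub>n \<in> \<Phi>\<close> with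
  \<open>\<bar>z\<^sub>n - z\<bar> \<le> r\<^sub>n\<close> and \<open>r\<^sub>n\<close> decreasing to \<open>0\<close>, and for each \<open>n\<close> errors \<open>s\<^sub>n\<^sub>,\<^sub>m\<close> decreasing to \<open>0\<close> in \<open>m\<close>
  within which, for a suitable gage, \<open>z\<^sub>n\<close> is approximated by every fine Riemann sum. Fine sums
  therefore contain some \<open>c\<close> with \<open>\<bar>z - c\<bar> \<le> r\<^sub>n + s\<^sub>n\<^sub>,\<^sub>m\<close>.

  It remains to find one regulator that dominates \<open>r\<^sub>n + s\<^sub>n\<^sub>,\<^sub>m\<close>, for suitable \<open>n\<close> and \<open>m\<close>, along every
  \<open>\<phi>\<close>. Row \<open>0\<close> of the regulator carries the \<open>r\<^sub>n\<close> and row \<open>n + 1\<close> the \<open>s\<^sub>n\<^sub>,\<^sub>m\<close>; then \<open>n = \<phi> 0\<close> and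
  \<open>m = \<phi> (n + 1)\<close> work (\<open>D_sequence_of_null_sequences\<close>). Nothing bounds the \<open>s\<^sub>n\<^sub>,\<^sub>m\<close> uniformly in \<open>n\<close>,
  so these rows must be truncated at a common bound \<open>u\<close> of all the \<open>\<bar>z - c\<bar>\<close>. This is where the
  boundedness of \<open>F\<close> enters: if \<open>F\<close> takes values in \<open>{- L..L}\<close>, all Riemann sums lie between
  \<open>- L \<cdot> \<mu> E\<close> and \<open>L \<cdot> \<mu> E\<close> (\<open>closed_Riemann_sum_bounded\<close>).
\<close>

section \<open>Regulators and decreasing sequences\<close>

lemma decreases_to_zero_sequence_iff:
  fixes r :: "nat \<Rightarrow> 'a::dedekind_complete_riesz"
  shows "decreases_to_zero UNIV (\<le>) r \<longleftrightarrow>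
    decseq r \<and> (\<forall>n. 0 \<le> r n) \<and> (\<forall>l. (\<forall>n. l \<le> r n) \<longrightarrow> l \<le> 0)"
proof
  assume r: "decreases_to_zero UNIV (\<le>) r"
  then have inf: "bdd_below (range r)" "(INF n. r n) = 0"
    by (simp_all add: decreases_to_zero_def)
  have "0 \<le> r n" for n
    using cINF_lower[OF inf(1), of n] inf(2) by simp
  moreover have "l \<le> 0" if "\<forall>n. l \<le> r n" for l
    using cINF_greatest[of UNIV l r] that inf(2) by simp
  ultimately show "decseq r \<and> (\<forall>n. 0 \<le> r n) \<and> (\<forall>l. (\<forall>n. l \<le> r n) \<longrightarrow> l \<le> 0)"
    using r by (auto simp: decreases_to_zero_def decseq_def)
next
  assume r: "decseq r \<and> (\<forall>n. 0 \<le> r n) \<and> (\<forall>l. (\<forall>n. l \<le> r n) \<longrightarrow> l \<le> 0)"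
  then have "bdd_below (range r)"
    by (auto intro: bdd_belowI)
  moreover have "(INF n. r n) = 0"
    using r by (intro cInf_eq_non_empty) auto
  moreover have "\<exists>k. i \<le> k \<and> j \<le> k" for i j :: nat
    by (meson max.cobounded1 max.cobounded2)
  ultimately show "decreases_to_zero UNIV (\<le>) r"
    using r by (auto simp: decreases_to_zero_def decseq_def intro!: reflp_onI transp_onI)
qed

lemma decreases_to_zero_scaleR:
  fixes r :: "nat \<Rightarrow> 'a::dedekind_complete_riesz"
  assumes "decreases_to_zero UNIV (\<le>) r" and "0 < c"
  shows "decreases_to_zero UNIV (\<le>) (\<lambda>n. c *\<^sub>R r n)"
proof -
  have "l \<le> 0" if "\<forall>n. l \<le> c *\<^sub>R r n" for l
  proof -
    have "l /\<^sub>R c \<le> r n" for n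
      using that \<open>0 < c\<close> by (simp add: pos_divideR_le_eq)
    then have "l /\<^sub>R c \<le> 0"
      using assms(1) by (auto simp: decreases_to_zero_sequence_iff)
    then show ?thesis
      using \<open>0 < c\<close> by (simp add: pos_divideR_le_eq)
  qed
  then show ?thesis
    using assms by (simp add: decreases_to_zero_sequence_iff decseq_def scaleR_left_mono scaleR_nonneg_nonneg)
qed

lemma decreases_to_zero_inf:
  fixes r :: "nat \<Rightarrow> 'a::dedekind_complete_riesz"
  assumes r: "decreases_to_zero UNIV (\<le>) r" and u: "0 \<le> u"
  shows "decreases_to_zero UNIV (\<le>) (\<lambda>n. inf u (r n))"
  using r u unfolding decreases_to_zero_sequence_iff decseq_def
  by (auto intro: le_infI2)

lemma D_sequence_iff:
  "D_sequence a \<longleftrightarrow> (\<exists>u. \<forall>i j. \<bar>a i j\<bar> \<le> u) \<and> (\<forall>i. decreases_to_zero UNIV (\<le>) (a i))"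
proof -
  have "decreases_to_zero UNIV (\<le>) (a i) \<longleftrightarrow> (\<forall>j. a i (Suc j) \<le> a i j) \<and> (INF j. a i j) = 0"
    if u: "\<forall>i j. \<bar>a i j\<bar> \<le> u" for i u
  proof -
    have "- u \<le> a i j" for j
      using u abs_le_D2 minus_le_iff by blast
    then have bdd: "bdd_below (range (a i))"
      by (intro bdd_belowI2)
    have dir: "\<exists>l. j \<le> l \<and> k \<le> l" for j k :: nat
      by (meson max.cobounded1 max.cobounded2)
    have "decseq (a i) \<longleftrightarrow> (\<forall>j. a i (Suc j) \<le> a i j)"
      by (auto simp: decseq_Suc_iff)
    then show ?thesis
      using bdd dir
      by (auto simp: decreases_to_zero_def decseq_def intro!: reflp_onI transp_onI)
  qed
  then show ?thesis
    unfolding D_sequence_def by blast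
qed

lemma D_sequence_zero: "D_sequence (\<lambda>i j. 0)"
  by (auto simp: D_sequence_def)

lemma D_sequence_bdd_above:
  assumes "D_sequence a"
  shows "bdd_above (range (\<lambda>i. a i (\<phi> i)))"
proof -
  obtain u where "\<bar>a i j\<bar> \<le> u" for i j
    using assms by (auto simp: D_sequence_def)
  then show ?thesis
    by (auto intro!: bdd_aboveI[of _ u] dest: abs_le_D1)
qed

lemma D_sequence_le_SUP:
  assumes "D_sequence a"
  shows "a i (\<phi> i) \<le> (SUP i. a i (\<phi> i))"
  by (rule cSUP_upper[OF UNIV_I D_sequence_bdd_above[OF assms]])

lemma D_sequence_SUP_nonneg:
  assumes "D_sequence a"
  shows "0 \<le> (SUP i. a i (\<phi> i))"
proof -
  have "0 \<le> a 0 (\<phi> 0)"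
    using assms by (simp add: D_sequence_iff decreases_to_zero_sequence_iff)
  then show ?thesis
    using D_sequence_le_SUP[OF assms, of 0 \<phi>] by (rule order_trans)
qed

lemma D_sequence_SUP_antimono:
  assumes "D_sequence a" and "\<And>i. \<phi> i \<le> \<psi> i"
  shows "(SUP i. a i (\<psi> i)) \<le> (SUP i. a i (\<phi> i))"
proof (rule cSUP_least)
  fix i
  have "a i (\<psi> i) \<le> a i (\<phi> i)"
    using assms by (simp add: D_sequence_iff decreases_to_zero_sequence_iff decseq_def)
  then show "a i (\<psi> i) \<le> (SUP i. a i (\<phi> i))"
    using D_sequence_le_SUP[OF assms(1), of i \<phi>] by (rule order_trans)
qed simp

lemma nonpos_if_le_all_SUP:
  fixes a :: "nat \<Rightarrow> nat \<Rightarrow> 'a::dedekind_complete_riesz"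
  assumes "weakly_sigma_distributive TYPE('a)" and "D_sequence a"
    and "\<And>\<phi>. l \<le> (SUP i. a i (\<phi> i))"
  shows "l \<le> 0"
proof -
  have "(INF \<phi>. SUP i. a i (\<phi> i)) = 0"
    using assms(1,2) by (simp add: weakly_sigma_distributive_def)
  then show ?thesis
    using cINF_greatest[of UNIV l "\<lambda>\<phi>. SUP i. a i (\<phi> i)"] assms(3) by simp
qed

text \<open>
  By weak \<open>\<sigma>\<close>-distributivity the suprema \<open>SUP i. a i (\<phi> i)\<close> have infimum \<open>0\<close>, and by super Dedekind
  completeness already countably many \<open>\<phi>\<^sub>0, \<phi>\<^sub>1, \<dots>\<close> achieve this. Since larger \<open>\<phi>\<close> give smaller
  suprema, the pointwise maxima of \<open>\<phi>\<^sub>0, \<dots>, \<phi>\<^sub>n\<close> turn these into a decreasing sequence.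
\<close>

lemma D_sequence_null_sequence:
  fixes a :: "nat \<Rightarrow> nat \<Rightarrow> 'a::dedekind_complete_riesz"
  assumes wsd: "weakly_sigma_distributive TYPE('a)"
    and sdc: "super_Dedekind_complete TYPE('a)"
    and a: "D_sequence a"
  obtains \<psi> :: "nat \<Rightarrow> nat \<Rightarrow> nat" where "decreases_to_zero UNIV (\<le>) (\<lambda>n. SUP i. a i (\<psi> n i))"
proof -
  define S where "S \<phi> = (SUP i. a i (\<phi> i))" for \<phi>
  have bdd: "bdd_above (range (\<lambda>\<phi>. - S \<phi>))"
    using D_sequence_SUP_nonneg[OF a] by (auto simp: S_def intro!: bdd_aboveI[of _ 0])
  then obtain C where C: "C \<subseteq> range (\<lambda>\<phi>. - S \<phi>)" "countable C" "C \<noteq> {}"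
      "Sup C = (SUP \<phi>. - S \<phi>)"
    using sdc unfolding super_Dedekind_complete_def by (metis UNIV_not_empty image_is_empty)
  have "\<exists>\<phi>. from_nat_into C n = - S \<phi>" for n
    using from_nat_into[OF C(3)] C(1) by blast
  then obtain \<phi> where \<phi>: "from_nat_into C n = - S (\<phi> n)" for n
    by metis
  have C_range: "C = range (\<lambda>n. - S (\<phi> n))"
    using range_from_nat_into[OF C(3,2)] \<phi> by simp
  define \<psi> where "\<psi> n i = (MAX k\<in>{..n}. \<phi> k i)" for n i
  have dec: "decseq (\<lambda>n. S (\<psi> n))"
  proof (rule decseq_SucI)
    fix n
    have "\<psi> n i \<le> \<psi> (Suc n) i" for i
      unfolding \<psi>_def by (intro Max_mono) auto
    then show "S (\<psi> (Suc n)) \<le> S (\<psi> n)"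
      unfolding S_def by (intro D_sequence_SUP_antimono[OF a])
  qed
  have null: "l \<le> 0" if l: "\<forall>n. l \<le> S (\<psi> n)" for l
  proof -
    have "l \<le> S (\<phi> n)" for n
    proof -
      have "\<phi> n i \<le> \<psi> n i" for i
        by (simp add: \<psi>_def)
      then have "S (\<psi> n) \<le> S (\<phi> n)"
        unfolding S_def by (intro D_sequence_SUP_antimono[OF a])
      then show ?thesis
        using l order_trans by blast
    qed
    then have "Sup C \<le> - l"
      using C(3) by (intro cSup_least) (auto simp: C_range)
    then have "- S \<phi> \<le> - l" for \<phi>
      using cSUP_upper[OF UNIV_I bdd, of \<phi>] C(4) by (metis order_trans)
    then show ?thesis
      using nonpos_if_le_all_SUP[OF wsd a, of l] by (simp add: S_def)
  qed
  have "decreases_to_zero UNIV (\<le>) (\<lambda>n. S (\<psi> n))"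
    using dec null D_sequence_SUP_nonneg[OF a] by (auto simp: decreases_to_zero_sequence_iff S_def)
  then show ?thesis
    using that by (simp add: S_def)
qed

text \<open>
  A regulator with \<open>r\<close> in its first row and \<open>s n\<close> in row \<open>n + 1\<close> lets \<open>\<phi>\<close> select the approximation
  step \<open>n = \<phi> 0\<close> first and then an accuracy \<open>m = \<phi> (n + 1)\<close> for this particular step. The
  supremum over the rows dominates \<open>r n + s n m\<close> because \<open>x + y \<le> sup (2 *\<^sub>R x) (2 *\<^sub>R y)\<close>. The
  truncation at \<open>u\<close> makes the double sequence bounded.
\<close>

lemma D_sequence_of_null_sequences:
  fixes r :: "nat \<Rightarrow> 'a::dedekind_complete_riesz"
  assumes r: "decreases_to_zero UNIV (\<le>) r"
    and s: "\<And>n::nat. decreases_to_zero (UNIV :: nat set) (\<le>) (s n)"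
    and u: "0 \<le> u"
  obtains d where "D_sequence d"
    and "\<forall>\<phi>. \<exists>n m. \<forall>x. x \<le> u \<and> x \<le> r n + s n m \<longrightarrow> x \<le> (SUP i. d i (\<phi> i))"
proof -
  define d where
    "d i j = (case i of 0 \<Rightarrow> 2 *\<^sub>R r j | Suc n \<Rightarrow> 2 *\<^sub>R inf u (s n j))" for i j
  have rows: "decreases_to_zero UNIV (\<le>) (d i)" for i
  proof (cases i)
    case 0
    then have "d i = (\<lambda>j. 2 *\<^sub>R r j)"
      by (auto simp: d_def)
    then show ?thesis
      using decreases_to_zero_scaleR[OF r] by simp
  next
    case (Suc n)
    then have "d i = (\<lambda>j. 2 *\<^sub>R inf u (s n j))"
      by (auto simp: d_def)
    then show ?thesis
      using decreases_to_zero_scaleR[OF decreases_to_zero_inf[OF s u]] by simp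
  qed
  have r_bounds: "0 \<le> r j" "r j \<le> r 0" for j
    using r by (auto simp: decreases_to_zero_sequence_iff decseq_def)
  have "\<bar>d i j\<bar> \<le> 2 *\<^sub>R (r 0 + u)" for i j
  proof -
    have "0 \<le> d i j"
      using rows by (simp add: decreases_to_zero_sequence_iff)
    moreover have "d i j \<le> 2 *\<^sub>R (r 0 + u)"
    proof (cases i)
      case 0
      have "r j \<le> r 0 + u"
        using add_mono[OF r_bounds(2)[of j] u] by simp
      then show ?thesis
        by (simp only: d_def 0 nat.case) (simp add: scaleR_left_mono del: scaleR_add_right)
    next
      case (Suc n)
      have "inf u (s n j) \<le> r 0 + u"
        using add_mono[OF r_bounds(1)[of 0] inf_le1[of u "s n j"]] by simp
      then show ?thesis
        by (simp only: d_def Suc nat.case) (simp add: scaleR_left_mono del: scaleR_add_right)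
    qed
    ultimately show ?thesis
      by simp
  qed
  then have D: "D_sequence d"
    using rows by (auto simp: D_sequence_iff)
  have "x \<le> (SUP i. d i (\<phi> i))"
    if "n = \<phi> 0" "m = \<phi> (Suc n)" "x \<le> u" "x \<le> r n + s n m" for \<phi> n m x
  proof -
    have sup: "2 *\<^sub>R r n \<le> (SUP i. d i (\<phi> i))" "2 *\<^sub>R inf u (s n m) \<le> (SUP i. d i (\<phi> i))"
      using D_sequence_le_SUP[OF D, of 0 \<phi>] D_sequence_le_SUP[OF D, of "Suc n" \<phi>] that(1,2)
      by (auto simp: d_def)
    have "x \<le> r n + u"
      using add_mono[OF r_bounds(1)[of n] \<open>x \<le> u\<close>] by simp
    then have "x \<le> r n + inf u (s n m)"
      using that(4) by (simp add: add_inf_distrib_left)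
    then have "2 *\<^sub>R x \<le> 2 *\<^sub>R r n + 2 *\<^sub>R inf u (s n m)"
      by (metis scaleR_add_right scaleR_left_mono zero_le_numeral)
    also have "\<dots> \<le> 2 *\<^sub>R (SUP i. d i (\<phi> i))"
      using add_mono[OF sup] by (simp add: scaleR_2)
    finally show ?thesis
      by (simp add: scaleR_le_cancel_left)
  qed
  then show ?thesis
    using that D by metis
qed

section \<open>Order bounds for Riemann sums\<close>

text \<open>
  A point of the closure exceeds \<open>M\<close> by at most \<open>SUP i. a i (\<phi> i)\<close> for every \<open>\<phi>\<close>, and weak
  \<open>\<sigma>\<close>-distributivity makes such an excess vanish.
\<close>

lemma D_closure_bounded:
  fixes C :: "'a::dedekind_complete_riesz set"
  assumes wsd: "weakly_sigma_distributive TYPE('a)"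
    and C: "\<And>x. x \<in> C \<Longrightarrow> \<bar>x\<bar> \<le> M"
    and c: "c \<in> D_closure C"
  shows "\<bar>c\<bar> \<le> M"
proof -
  obtain a where a: "D_sequence a" and near: "c \<in> nbhd C (SUP i. a i (\<phi> i))" for \<phi>
    using c by (auto simp: D_closure_def)
  have "\<bar>c\<bar> - M \<le> (SUP i. a i (\<phi> i))" for \<phi>
  proof -
    obtain x where x: "x \<in> C" "\<bar>x - c\<bar> \<le> (SUP i. a i (\<phi> i))"
      using near by (auto simp: nbhd_def)
    have "\<bar>c\<bar> \<le> \<bar>x\<bar> + \<bar>x - c\<bar>"
      using abs_triangle_ineq[of x "c - x"] by (simp add: abs_minus_commute)
    also have "\<dots> \<le> M + (SUP i. a i (\<phi> i))"
      by (rule add_mono[OF C[OF x(1)] x(2)])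
    finally show ?thesis
      by (simp add: diff_le_eq add.commute)
  qed
  then have "\<bar>c\<bar> - M \<le> 0"
    by (rule nonpos_if_le_all_SUP[OF wsd a])
  then show ?thesis
    by simp
qed

text \<open>
  An overlap of \<open>\<mu>\<close>-measure zero does not disturb additivity: positivity makes every measurable
  subset of the overlap null.
\<close>

lemma additive_almost_disjoint_sum:
  fixes \<mu> :: "'b set \<Rightarrow> 'a::ordered_ab_group_add"
  assumes M: "algebra \<Omega> M"
    and pos: "\<And>A. A \<in> M \<Longrightarrow> 0 \<le> \<mu> A"
    and add: "additive M \<mu>"
    and "finite I"
    and "\<And>i. i \<in> I \<Longrightarrow> A i \<in> M"
    and "\<And>i j. i \<in> I \<Longrightarrow> j \<in> I \<Longrightarrow> i \<noteq> j \<Longrightarrow> \<mu> (A i \<inter> A j) = 0"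
  shows "\<mu> (\<Union>i\<in>I. A i) = (\<Sum>i\<in>I. \<mu> (A i))"
proof -
  interpret algebra \<Omega> M by (rule M)
  have mono: "\<mu> B \<le> \<mu> C" if "B \<in> M" "C \<in> M" "B \<subseteq> C" for B C
  proof -
    have "\<mu> (B \<union> (C - B)) = \<mu> B + \<mu> (C - B)"
      using that by (intro additiveD[OF add]) auto
    moreover have "B \<union> (C - B) = C"
      using that by auto
    ultimately show ?thesis
      using pos[of "C - B"] that by (simp add: Diff)
  qed
  have empty: "\<mu> {} = 0"
    using additiveD[OF add, of "{}" "{}"] by simp
  show ?thesis
    using assms(4-6)
  proof (induction I rule: finite_induct)
    case empty
    then show ?case
      by (simp add: \<open>\<mu> {} = 0\<close>)
  next
    case (insert k I)
    define B where "B = (\<Union>i\<in>I. A i)"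
    have B: "B \<in> M"
      unfolding B_def using insert by (intro finite_UN) auto
    have A: "A k \<in> M"
      using insert by simp
    have null: "\<mu> (\<Union>i\<in>J. A k \<inter> A i) = 0" if "finite J" "J \<subseteq> I" for J
      using that
    proof (induction J rule: finite_induct)
      case empty
      then show ?case
        by (simp add: \<open>\<mu> {} = 0\<close>)
    next
      case (insert j J)
      let ?V = "\<Union>i\<in>J. A k \<inter> A i"
      have "j \<in> I" "J \<subseteq> I"
        using insert by auto
      then have W: "A k \<inter> A j \<in> M" "?V \<in> M" "\<mu> (A k \<inter> A j) = 0" "\<mu> ?V = 0"
        using insert.IH \<open>k \<notin> I\<close> \<open>finite J\<close> insert.prems
          \<open>\<And>i. i \<in> Set.insert k I \<Longrightarrow> A i \<in> M\<close>
          \<open>\<And>i j. i \<in> Set.insert k I \<Longrightarrow> j \<in> Set.insert k I \<Longrightarrow> i \<noteq> j \<Longrightarrow> \<mu> (A i \<inter> A j) = 0\<close>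
        by (auto intro!: finite_UN)
      have "\<mu> (A k \<inter> A j \<union> (?V - A k \<inter> A j)) = \<mu> (A k \<inter> A j) + \<mu> (?V - A k \<inter> A j)"
        using W by (intro additiveD[OF add]) auto
      also have "\<dots> \<le> 0"
        using mono[of "?V - A k \<inter> A j" ?V] W by auto
      finally have "\<mu> (A k \<inter> A j \<union> (?V - A k \<inter> A j)) \<le> 0" .
      moreover have "A k \<inter> A j \<union> (?V - A k \<inter> A j) = (\<Union>i\<in>Set.insert j J. A k \<inter> A i)"
        by auto
      ultimately have "\<mu> (\<Union>i\<in>Set.insert j J. A k \<inter> A i) \<le> 0"
        by simp
      moreover have "0 \<le> \<mu> (\<Union>i\<in>Set.insert j J. A k \<inter> A i)"
        using W by (intro pos) auto
      ultimately show ?case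
        by simp
    qed
    have "A k \<inter> B = (\<Union>i\<in>I. A k \<inter> A i)"
      by (auto simp: B_def)
    then have "\<mu> (A k \<inter> B) = 0"
      using null[OF \<open>finite I\<close>] by simp
    moreover have "\<mu> (A k \<inter> B \<union> (A k - B)) = \<mu> (A k \<inter> B) + \<mu> (A k - B)"
      using A B by (intro additiveD[OF add]) auto
    moreover have "A k \<inter> B \<union> (A k - B) = A k"
      by auto
    ultimately have "\<mu> (A k - B) = \<mu> (A k)"
      by simp
    moreover have "\<mu> ((A k - B) \<union> B) = \<mu> (A k - B) + \<mu> B"
      using A B by (intro additiveD[OF add]) auto
    ultimately have "\<mu> (A k \<union> B) = \<mu> (A k) + \<mu> B"
      by simp
    then show ?case
      using insert by (simp add: B_def)
  qed
qed

lemma abs_mul_le: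
  assumes mul: "Dedekind_complete_algebra mul" and "\<bar>x\<bar> \<le> L" and "0 \<le> m"
  shows "\<bar>mul x m\<bar> \<le> mul L m"
proof -
  have add: "mul (r + s) m = mul r m + mul s m"
    and mono: "s \<le> r \<Longrightarrow> mul s m \<le> mul r m" for r s
    using mul \<open>0 \<le> m\<close> by (simp_all add: Dedekind_complete_algebra_def)
  have "mul 0 m = 0"
    using add[of 0 0] by simp
  then have "mul (- x) m = - mul x m"
    using add[of x "- x"] by (metis add.inverse_unique add.right_inverse)
  moreover have "mul x m \<le> mul L m" "mul (- x) m \<le> mul L m"
    using assms(2) by (auto intro!: mono dest: abs_le_D1 abs_le_D2)
  ultimately show ?thesis
    by (simp add: abs_leI)
qed

lemma mul_sum_right:
  assumes mul: "Dedekind_complete_algebra mul"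
  shows "mul x (\<Sum>i\<in>I. f i) = (\<Sum>i\<in>I. mul x (f i))"
proof -
  have add: "mul x (r + s) = mul x r + mul x s" for r s
    using mul by (simp add: Dedekind_complete_algebra_def)
  have "mul x 0 = 0"
    using add[of 0 0] by simp
  then show ?thesis
    by (induction I rule: infinite_finite_induct) (simp_all add: add)
qed

text \<open>
  Every elementwise Riemann sum is dominated by \<open>L \<cdot> \<Sum> \<mu> (A i) = L \<cdot> \<mu> E\<close>, which depends on neither the
  partition nor its tags; passing to the closure keeps the bound.
\<close>

lemma closed_Riemann_sum_bounded:
  fixes mul :: "'a::dedekind_complete_riesz \<Rightarrow> 'a \<Rightarrow> 'a"
    and \<mu> :: "'b::metric_space set \<Rightarrow> 'a"
  assumes wsd: "weakly_sigma_distributive TYPE('a)"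
    and mul: "Dedekind_complete_algebra mul"
    and pos: "\<And>A. A \<in> sets borel \<Longrightarrow> 0 \<le> \<mu> A"
    and add: "additive (sets borel) \<mu>"
    and F: "\<And>t. F t \<subseteq> {- L..L}"
    and part: "tagged_partition \<mu> E k A t"
    and c: "c \<in> closed_sum k (\<lambda>i. (\<lambda>x. mul x (\<mu> (A i))) ` F (t i))"
  shows "\<bar>c\<bar> \<le> mul L (\<mu> E)"
proof (rule D_closure_bounded[OF wsd _ c[unfolded closed_sum_def]])
  fix y assume "y \<in> (\<Sum>i=1..k. (\<lambda>x. mul x (\<mu> (A i))) ` F (t i))"
  then obtain f where f: "\<And>i. i \<in> {1..k} \<Longrightarrow> f i \<in> (\<lambda>x. mul x (\<mu> (A i))) ` F (t i)"
      and y: "y = (\<Sum>i=1..k. f i)"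
    unfolding set_sum_alt[OF finite_atLeastAtMost] by blast
  have "\<bar>y\<bar> \<le> (\<Sum>i=1..k. \<bar>f i\<bar>)"
    unfolding y by (rule sum_abs)
  also have "\<dots> \<le> (\<Sum>i=1..k. mul L (\<mu> (A i)))"
  proof (rule sum_mono)
    fix i assume i: "i \<in> {1..k}"
    then obtain x where x: "x \<in> F (t i)" "f i = mul x (\<mu> (A i))"
      using f by blast
    have "- L \<le> x \<and> x \<le> L"
      using F x(1) by fastforce
    then have "\<bar>x\<bar> \<le> L"
      by (simp add: abs_leI minus_le_iff)
    moreover have "0 \<le> \<mu> (A i)"
      using part i by (auto simp: tagged_partition_def intro: pos)
    ultimately show "\<bar>f i\<bar> \<le> mul L (\<mu> (A i))"
      by (simp add: x(2) abs_mul_le[OF mul])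
  qed
  also have "\<dots> = mul L (\<Sum>i=1..k. \<mu> (A i))"
    by (simp add: mul_sum_right[OF mul])
  also have "(\<Sum>i=1..k. \<mu> (A i)) = \<mu> (\<Union>i\<in>{1..k}. A i)"
    using part
    by (intro additive_almost_disjoint_sum[OF sets.algebra_axioms pos add, symmetric])
       (auto simp: tagged_partition_def)
  also have "(\<Union>i\<in>{1..k}. A i) = E"
    using part by (simp add: tagged_partition_def)
  finally show "\<bar>y\<bar> \<le> mul L (\<mu> E)" .
qed

section \<open>Closedness of the integral\<close>

lemma subset_D_closure: "C \<subseteq> D_closure C"
  unfolding D_closure_def nbhd_def
  by (force intro: exI[of _ "\<lambda>i j. 0"] D_sequence_zero)

theorem proposition13:
  fixes mul :: "'a::dedekind_complete_riesz \<Rightarrow> 'a \<Rightarrow> 'a"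
    and \<mu> :: "'b::metric_space set \<Rightarrow> 'a"
    and F :: "'b \<Rightarrow> 'a set"
    and E :: "'b set"
  assumes "weakly_sigma_distributive TYPE('a)"
    and "Dedekind_complete_algebra mul"
    and "compact (UNIV :: 'b set)"
    and "\<And>A. A \<in> sets borel \<Longrightarrow> 0 \<le> \<mu> A"
    and "additive (sets borel) \<mu>"
    and "regular_mapping \<mu>"
    and "E \<in> sets borel"
    and "bounded_multifunction F"
    and "super_Dedekind_complete TYPE('a)"
  shows "D_closed (star_integral mul \<mu> F E)"
proof -
  note wsd = assms(1) and mul = assms(2) and pos = assms(4) and add = assms(5)
    and sdc = assms(9)
  let ?\<Phi> = "star_integral mul \<mu> F E"
  let ?sums = "\<lambda>k A t. closed_sum k (\<lambda>i. (\<lambda>x. mul x (\<mu> (A i))) ` F (t i))"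
  obtain L where L: "\<And>t. F t \<subseteq> {- L..L}"
    using assms(8) by (auto simp: bounded_multifunction_def)
  have "z \<in> ?\<Phi>" if z: "z \<in> D_closure ?\<Phi>" for z
  proof -
    obtain a where a: "D_sequence a" and near: "\<And>\<phi>. z \<in> nbhd ?\<Phi> (SUP i. a i (\<phi> i))"
      using z by (auto simp: D_closure_def)
    obtain \<alpha> :: "nat \<Rightarrow> nat \<Rightarrow> nat" where null_a: "decreases_to_zero UNIV (\<le>) (\<lambda>n. SUP i. a i (\<alpha> n i))"
      using D_sequence_null_sequence[OF wsd sdc a] .
    define r where "r n = (SUP i. a i (\<alpha> n i))" for n
    have r: "decreases_to_zero UNIV (\<le>) r"
      using null_a by (simp add: r_def[abs_def])
    have "\<exists>w \<in> ?\<Phi>. \<bar>w - z\<bar> \<le> r n" for n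
      using near[of "\<alpha> n"] by (simp add: nbhd_def r_def)
    then obtain w where w: "\<And>n. w n \<in> ?\<Phi>" "\<And>n. \<bar>w n - z\<bar> \<le> r n"
      by metis
    have "\<exists>s :: nat \<Rightarrow> 'a. decreases_to_zero UNIV (\<le>) s \<and> (\<forall>m. \<exists>\<gamma>. gage \<gamma> \<and>
        (\<forall>k A t. tagged_partition \<mu> E k A t \<and> gage_fine \<gamma> k A t \<longrightarrow>
          (\<exists>c \<in> ?sums k A t. \<bar>w n - c\<bar> \<le> s m)))" for n
    proof -
      obtain b where b: "D_sequence b"
        and fine: "\<And>\<phi>. \<exists>\<gamma>. gage \<gamma> \<and>
          (\<forall>k A t. tagged_partition \<mu> E k A t \<and> gage_fine \<gamma> k A t \<longrightarrow>
            (\<exists>c \<in> ?sums k A t. \<bar>w n - c\<bar> \<le> (SUP i. b i (\<phi> i))))"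
        using w(1)[of n] unfolding star_integral_def by blast
      obtain \<beta> :: "nat \<Rightarrow> nat \<Rightarrow> nat"
        where "decreases_to_zero UNIV (\<le>) (\<lambda>m. SUP i. b i (\<beta> m i))"
        using D_sequence_null_sequence[OF wsd sdc b] .
      then show ?thesis
        by (intro exI[of _ "\<lambda>m. SUP i. b i (\<beta> m i)"] conjI allI fine)
    qed
    then have "\<exists>s. \<forall>n. decreases_to_zero (UNIV :: nat set) (\<le>) (s n) \<and> (\<forall>m. \<exists>\<gamma>. gage \<gamma> \<and>
        (\<forall>k A t. tagged_partition \<mu> E k A t \<and> gage_fine \<gamma> k A t \<longrightarrow>
          (\<exists>c \<in> ?sums k A t. \<bar>w n - c\<bar> \<le> s n m)))"
      by (intro choice allI)
    then obtain s where "\<forall>n. decreases_to_zero (UNIV :: nat set) (\<le>) (s n) \<and> (\<forall>m. \<exists>\<gamma>. gage \<gamma> \<and>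
        (\<forall>k A t. tagged_partition \<mu> E k A t \<and> gage_fine \<gamma> k A t \<longrightarrow>
          (\<exists>c \<in> ?sums k A t. \<bar>w n - c\<bar> \<le> s n m)))" ..
    then have s: "\<And>n. decreases_to_zero (UNIV :: nat set) (\<le>) (s n)"
      and fine: "\<And>n m. \<exists>\<gamma>. gage \<gamma> \<and>
        (\<forall>k A t. tagged_partition \<mu> E k A t \<and> gage_fine \<gamma> k A t \<longrightarrow>
          (\<exists>c \<in> ?sums k A t. \<bar>w n - c\<bar> \<le> s n m))"
      by simp_all
    \<comment> \<open>A bound for \<open>\<bar>z - c\<bar>\<close> that serves all Riemann sums \<open>c\<close>\<close>
    define u where "u = \<bar>z\<bar> + \<bar>mul L (\<mu> E)\<bar>"
    have "0 \<le> u"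
      by (simp add: u_def)
    obtain d where d: "D_sequence d"
      and dom: "\<forall>\<phi>. \<exists>n m. \<forall>x. x \<le> u \<and> x \<le> r n + s n m \<longrightarrow> x \<le> (SUP i. d i (\<phi> i))"
      by (rule D_sequence_of_null_sequences[where s = s, OF r s \<open>0 \<le> u\<close>])
    have "\<exists>\<gamma>. gage \<gamma> \<and> (\<forall>k A t. tagged_partition \<mu> E k A t \<and> gage_fine \<gamma> k A t \<longrightarrow>
        (\<exists>c \<in> ?sums k A t. \<bar>z - c\<bar> \<le> (SUP i. d i (\<phi> i))))" for \<phi>
    proof -
      obtain n m where dom_nm: "\<And>x. x \<le> u \<Longrightarrow> x \<le> r n + s n m \<Longrightarrow> x \<le> (SUP i. d i (\<phi> i))"
        using spec[OF dom, of \<phi>] by blast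
      obtain \<gamma> where "gage \<gamma>" and \<gamma>: "\<And>k A t. tagged_partition \<mu> E k A t \<Longrightarrow>
          gage_fine \<gamma> k A t \<Longrightarrow> \<exists>c \<in> ?sums k A t. \<bar>w n - c\<bar> \<le> s n m"
        using fine[of n m] by auto
      have "\<exists>c \<in> ?sums k A t. \<bar>z - c\<bar> \<le> (SUP i. d i (\<phi> i))"
        if part: "tagged_partition \<mu> E k A t" and gf: "gage_fine \<gamma> k A t" for k A t
      proof -
        obtain c where c: "c \<in> ?sums k A t" and wc: "\<bar>w n - c\<bar> \<le> s n m"
          using \<gamma>[OF part gf] by blast
        have "\<bar>z - c\<bar> \<le> \<bar>z\<bar> + \<bar>c\<bar>"
          by (rule abs_triangle_ineq4)
        also have "\<dots> \<le> u"
          unfolding u_def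
          using closed_Riemann_sum_bounded[OF wsd mul pos add L part c]
          by (meson abs_ge_self add_left_mono order_trans)
        finally have "\<bar>z - c\<bar> \<le> u" .
        moreover have "\<bar>z - c\<bar> \<le> r n + s n m"
        proof -
          have "\<bar>z - c\<bar> \<le> \<bar>z - w n\<bar> + \<bar>w n - c\<bar>"
            using abs_triangle_ineq[of "z - w n" "w n - c"] by simp
          also have "\<dots> \<le> r n + s n m"
            using w(2)[of n] wc by (intro add_mono) (simp_all add: abs_minus_commute)
          finally show ?thesis .
        qed
        ultimately show ?thesis
          using dom_nm c by blast
      qed
      then show ?thesis
        using \<open>gage \<gamma>\<close> by blast
    qed
    then show ?thesis
      using d by (auto simp: star_integral_def)
  qed
  then show ?thesis
    using subset_D_closure unfolding D_closed_def by blast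
qed

end
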